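(* Let $\mathrm{DS} = \{\langle e,x,u\rangle : (\forall y)[L^e_x \neq L^e_y \rightarrow L^e_x \cap D_u \neq L^e_y \cap D_u]\}$. Then $\mathrm{DS}$ is $\Pi^0_2$-complete.
   Context: $W_0,W_1,\ldots$ is an acceptable numbering of all recursively enumerable (r.e.) subsets of $\mathbb N$, and $\langle\cdot,\cdot\rangle$ (and its iterates for tuples) is a standard recursive pairing function. For all $e,j$, $L^e_j = \{x : \langle j,x\rangle \in W_e\}$ (the $j$th column of $W_e$), and $\mathcal L_e = \{L^e_j : j\in\mathbb N\}$; the $\mathcal L_e$ range over all uniformly r.e. families. $D_0,D_1,\ldots$ is the canonical numbering of finite sets: $D_0=\emptyset$ and $D_{2^{x_1}+\cdots+2^{x_n}} = \{x_1,\ldots,x_n\}$ for pairwise distinct $x_1,\ldots,x_n$. A set $A\subseteq\mathbb N$ is $\Pi^0_n$-complete if it is definable by a $\Pi^0_n$ formula and every $\Pi^0_n$ set is many-one reducible to $A$ via a recursive function (similarly for $\Sigma^0_n$). *)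

theory Defs
  imports Main "HOL-Library.Nat_Bijection"
begin

datatype recf =
    Zero
  | Succ
  | Proj nat
  | Comp recf "recf list"
  | PrimRec recf recf
  | Mu recf

text \<open>
  Programs carry no arity: on arguments of unsuitable length evaluation gives None or an
  irrelevant value, and for each fixed length k the functions computed on lists of length k are
  exactly the k-ary partial recursive functions. The recursion argument of \<open>PrimRec\<close> and the
  search argument of \<open>Mu\<close> come first.
\<close>

fun eval :: "recf \<Rightarrow> nat list \<Rightarrow> nat option" where
  "eval Zero xs = Some 0"
| "eval Succ xs = (case xs of [x] \<Rightarrow> Some (Suc x) | _ \<Rightarrow> None)"
| "eval (Proj i) xs = (if i < length xs then Some (xs ! i) else None)"
| "eval (Comp f gs) xs = Option.bind (those (map (\<lambda>g. eval g xs) gs)) (eval f)"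
| "eval (PrimRec f g) xs =
     (case xs of
        [] \<Rightarrow> None
      | n # ys \<Rightarrow>
          rec_nat (eval f ys) (\<lambda>m r. Option.bind r (\<lambda>v. eval g (m # v # ys))) n)"
| "eval (Mu f) xs =
     (if \<exists>n. eval f (n # xs) = Some 0 \<and> (\<forall>m<n. eval f (m # xs) \<noteq> None)
      then Some (LEAST n. eval f (n # xs) = Some 0)
      else None)"

definition recursive_fun :: "(nat \<Rightarrow> nat) \<Rightarrow> bool" where
  "recursive_fun f \<longleftrightarrow> (\<exists>c. \<forall>x. eval c [x] = Some (f x))"

definition recursive_rel :: "nat \<Rightarrow> (nat list \<Rightarrow> bool) \<Rightarrow> bool" where
  "recursive_rel k R \<longleftrightarrow>
     (\<exists>c. \<forall>xs. length xs = k \<longrightarrow> eval c xs = Some (if R xs then 1 else 0))"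

definition re_set :: "nat set \<Rightarrow> bool" where
  "re_set A \<longleftrightarrow> (\<exists>c. A = {x. eval c [x] \<noteq> None})"

abbreviation pair :: "nat \<Rightarrow> nat \<Rightarrow> nat" where
  "pair x y \<equiv> prod_encode (x, y)"

abbreviation triple :: "nat \<Rightarrow> nat \<Rightarrow> nat \<Rightarrow> nat" where
  "triple x y z \<equiv> pair x (pair y z)"

definition uniformly_re :: "(nat \<Rightarrow> nat set) \<Rightarrow> bool" where
  "uniformly_re V \<longleftrightarrow> re_set {pair e x | e x. x \<in> V e}"

definition acceptable_numbering :: "(nat \<Rightarrow> nat set) \<Rightarrow> bool" where
  "acceptable_numbering W \<longleftrightarrow>
     range W = {A. re_set A} \<and>
     uniformly_re W \<and>
     (\<forall>V. uniformly_re V \<longrightarrow> (\<exists>f. recursive_fun f \<and> (\<forall>e. V e = W (f e))))"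

definition column :: "(nat \<Rightarrow> nat set) \<Rightarrow> nat \<Rightarrow> nat \<Rightarrow> nat set" where
  "column W e j = {x. pair j x \<in> W e}"

text \<open>
  \<open>Sigma_rel n k R\<close> and \<open>Pi_rel n k R\<close>: the relation \<open>R\<close>, restricted to lists of length k, is
  definable by a prefix of n alternating number quantifiers, the outermost being existential resp.
  universal, in front of a recursive relation. The variable of the outermost quantifier is put at
  the head of the argument list.
\<close>

fun Sigma_rel :: "nat \<Rightarrow> nat \<Rightarrow> (nat list \<Rightarrow> bool) \<Rightarrow> bool"
  and Pi_rel :: "nat \<Rightarrow> nat \<Rightarrow> (nat list \<Rightarrow> bool) \<Rightarrow> bool" where
  "Sigma_rel 0 k R \<longleftrightarrow> recursive_rel k R"
| "Sigma_rel (Suc n) k R \<longleftrightarrow>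
     (\<exists>Q. Pi_rel n (Suc k) Q \<and> (\<forall>xs. length xs = k \<longrightarrow> (R xs \<longleftrightarrow> (\<exists>y. Q (y # xs)))))"
| "Pi_rel 0 k R \<longleftrightarrow> recursive_rel k R"
| "Pi_rel (Suc n) k R \<longleftrightarrow>
     (\<exists>Q. Sigma_rel n (Suc k) Q \<and> (\<forall>xs. length xs = k \<longrightarrow> (R xs \<longleftrightarrow> (\<forall>y. Q (y # xs)))))"

definition Pi_set :: "nat \<Rightarrow> nat set \<Rightarrow> bool" where
  "Pi_set n A \<longleftrightarrow> Pi_rel n 1 (\<lambda>xs. xs ! 0 \<in> A)"

definition many_one_reducible :: "nat set \<Rightarrow> nat set \<Rightarrow> bool" where
  "many_one_reducible B A \<longleftrightarrow> (\<exists>f. recursive_fun f \<and> (\<forall>x. x \<in> B \<longleftrightarrow> f x \<in> A))"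

definition Pi_complete :: "nat \<Rightarrow> nat set \<Rightarrow> bool" where
  "Pi_complete n A \<longleftrightarrow> Pi_set n A \<and> (\<forall>B. Pi_set n B \<longrightarrow> many_one_reducible B A)"

text \<open>
  The canonical finite set with index u is \<open>set_decode u\<close>, the set of positions of the binary
  digits 1 of u.
\<close>

definition DS :: "(nat \<Rightarrow> nat set) \<Rightarrow> nat set" where
  "DS W = {triple e x u | e x u.
     \<forall>y. column W e x \<noteq> column W e y \<longrightarrow>
         column W e x \<inter> set_decode u \<noteq> column W e y \<inter> set_decode u}"

end

theory Submission
  imports Defs
begin

section \<open>Total recursive functions and relations on tuples\<close>

text \<open>Membership. A triple lies in \<open>DS W\<close> iff for all y and w the columns x and y
  differ at some v in the finite set coded by u or agree at w (\<open>in_DS_iff\<close>). For fixed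
  y and w this is a Boolean combination, with a bounded quantifier over v, of statements that an
  r.e. set contains a given number. Each such statement is the limit of recursive approximations at
  stages t, hence so is the combination, and a convergent relation holds in the limit iff it holds
  at infinitely many stages (\<open>infinitely_often_iff_limit\<close>). This costs only the
  quantifiers "for all s there is t \<ge> s", and the universal quantifiers over y, w and s contract
  into one by pairing, which gives \<open>Pi_set_DS\<close>. The approximations come from
  \<open>clocked\<close>, a total evaluator that cuts off every search. It eventually agrees with
  \<open>eval\<close> on definedness (\<open>eventually_clocked_iff\<close>) and is recursive for
  each fixed program (\<open>total_recursive_clocked\<close>).

  Hardness (\<open>Pi_set_reducible_DS\<close>). Let n \<in> B iff every a has a witness b with R(b,
  a, n). Take the family whose column 0 is the set of all numbers and whose other columns all equal
  the set S of those a that have a witness. The empty set distinguishes no two columns, so it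
  separates column 0 from every column different from it iff S is everything, that is, iff n \<in>
  B. Acceptability of the numbering makes an index of this family recursive in n.\<close>

definition total_recursive :: "nat \<Rightarrow> (nat list \<Rightarrow> nat) \<Rightarrow> bool" where
  "total_recursive k F \<longleftrightarrow> (\<exists>c. \<forall>xs. length xs = k \<longrightarrow> eval c xs = Some (F xs))"

text \<open>Passing to characteristic functions lets the closure properties of relations follow from
  arithmetic on values.\<close>

lemma recursive_rel_iff:
  "recursive_rel k R \<longleftrightarrow> total_recursive k (\<lambda>xs. if R xs then 1 else 0)"
  by (simp add: recursive_rel_def total_recursive_def)

lemma recursive_fun_iff: "recursive_fun f \<longleftrightarrow> total_recursive 1 (\<lambda>xs. f (xs ! 0))"
proof -
  have "(\<forall>xs. length xs = 1 \<longrightarrow> eval c xs = Some (f (xs ! 0))) \<longleftrightarrow> (\<forall>x. eval c [x] = Some (f x))" for c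
    by (force simp: length_Suc_conv)
  then show ?thesis
    unfolding recursive_fun_def total_recursive_def by simp
qed

lemma total_recursive_cong:
  assumes "total_recursive k F" and "\<And>xs. length xs = k \<Longrightarrow> F xs = G xs"
  shows "total_recursive k G"
  using assms by (auto simp: total_recursive_def)

lemma recursive_rel_cong:
  assumes "recursive_rel k R" and "\<And>xs. length xs = k \<Longrightarrow> R xs \<longleftrightarrow> S xs"
  shows "recursive_rel k S"
  using assms by (auto simp: recursive_rel_def)

lemma those_map:
  "those (map f xs) = (if \<forall>x\<in>set xs. f x \<noteq> None then Some (map (\<lambda>x. the (f x)) xs) else None)"
  by (induction xs) (auto split: option.splits)

section \<open>Composition and rearrangement of arguments\<close>

lemma total_recursive_nth: "i < k \<Longrightarrow> total_recursive k (\<lambda>xs. xs ! i)"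
  unfolding total_recursive_def by (rule exI[of _ "Proj i"]) auto

lemma total_recursive_comp:
  assumes F: "total_recursive m F" and len: "length Gs = m"
    and Gs: "\<And>G. G \<in> set Gs \<Longrightarrow> total_recursive k G"
  shows "total_recursive k (\<lambda>xs. F (map (\<lambda>G. G xs) Gs))"
proof -
  obtain f where f: "\<And>xs. length xs = m \<Longrightarrow> eval f xs = Some (F xs)"
    using F by (auto simp: total_recursive_def)
  have "\<exists>c. \<forall>G\<in>set Gs. \<forall>xs. length xs = k \<longrightarrow> eval (c G) xs = Some (G xs)"
    using Gs unfolding total_recursive_def by metis
  then obtain c where c: "\<And>G xs. G \<in> set Gs \<Longrightarrow> length xs = k \<Longrightarrow> eval (c G) xs = Some (G xs)"
    by blast
  have "eval (Comp f (map c Gs)) xs = Some (F (map (\<lambda>G. G xs) Gs))" if "length xs = k" for xs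
  proof -
    have "those (map (\<lambda>g. eval g xs) (map c Gs)) = Some (map (\<lambda>G. G xs) Gs)"
      using that c by (simp add: those_map)
    then show ?thesis
      using len by (simp add: f)
  qed
  then show ?thesis
    unfolding total_recursive_def by blast
qed

lemma total_recursive_comp1:
  assumes "total_recursive 1 F" "total_recursive k G"
  shows "total_recursive k (\<lambda>xs. F [G xs])"
  using total_recursive_comp[OF assms(1), of "[G]" k] assms(2) by simp

lemma total_recursive_comp2:
  assumes "total_recursive 2 F" "total_recursive k G" "total_recursive k H"
  shows "total_recursive k (\<lambda>xs. F [G xs, H xs])"
  using total_recursive_comp[OF assms(1), of "[G, H]" k] assms(2-) by auto

lemma total_recursive_comp3:
  assumes "total_recursive 3 F" "total_recursive k G" "total_recursive k H" "total_recursive k I"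
  shows "total_recursive k (\<lambda>xs. F [G xs, H xs, I xs])"
  using total_recursive_comp[OF assms(1), of "[G, H, I]" k] assms(2-) by auto

text \<open>Rebuilding the argument list out of projections makes any deletion, insertion or
  permutation of arguments an instance of composition. The same device recurs below.\<close>

lemma total_recursive_drop:
  assumes "total_recursive k F"
  shows "total_recursive (n + k) (\<lambda>xs. F (drop n xs))"
proof -
  have "total_recursive (n + k)
      (\<lambda>xs. F (map (\<lambda>G. G xs) (map (\<lambda>i xs. xs ! (n + i)) [0..<k])))"
    using assms by (rule total_recursive_comp) (auto intro: total_recursive_nth)
  then show ?thesis
    by (rule total_recursive_cong) (auto intro!: arg_cong[of _ _ F] nth_equalityI)
qed

lemma total_recursive_tl:
  "total_recursive k F \<Longrightarrow> total_recursive (Suc k) (\<lambda>xs. F (tl xs))"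
  using total_recursive_drop[of k F 1] by (simp add: drop_Suc)

lemma total_recursive_Cons:
  assumes F: "total_recursive (Suc k) F" and A: "total_recursive k A"
  shows "total_recursive k (\<lambda>xs. F (A xs # xs))"
proof -
  have "total_recursive k (\<lambda>xs. F (map (\<lambda>G. G xs) (A # map (\<lambda>i xs. xs ! i) [0..<k])))"
    using F by (rule total_recursive_comp) (auto intro: A total_recursive_nth)
  then show ?thesis
    by (rule total_recursive_cong) (auto intro!: arg_cong[of _ _ F] nth_equalityI)
qed

section \<open>Constants, primitive recursion, minimization and arithmetic\<close>

lemma total_recursive_Suc:
  "total_recursive k F \<Longrightarrow> total_recursive k (\<lambda>xs. Suc (F xs))"
proof -
  have "total_recursive 1 (\<lambda>xs. Suc (xs ! 0))"
    unfolding total_recursive_def by (rule exI[of _ Succ]) (auto simp: length_Suc_conv)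
  then show "total_recursive k F \<Longrightarrow> ?thesis"
    using total_recursive_comp1 by fastforce
qed

lemma total_recursive_const: "total_recursive k (\<lambda>_. n)"
proof (induction n)
  case 0
  show ?case
    unfolding total_recursive_def by (rule exI[of _ Zero]) simp
next
  case (Suc n)
  then show ?case
    by (rule total_recursive_Suc)
qed

text \<open>\<open>PrimRec\<close> recurses on the head of the list and hands its step the counter,
  the previous value and then the parameters, which explains the shape of the hypothesis on
  \<open>B\<close>. The recursion depth \<open>N xs\<close> is substituted for the head afterwards.
  Arithmetic operations can then be given simply as \<open>rec_nat\<close> terms.\<close>

lemma total_recursive_rec_nat:
  assumes N: "total_recursive k N" and A: "total_recursive k A"
    and B: "total_recursive (Suc (Suc k)) (\<lambda>ys. B (ys ! 0) (ys ! 1) (tl (tl ys)))"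
  shows "total_recursive k (\<lambda>xs. rec_nat (A xs) (\<lambda>m r. B m r xs) (N xs))"
proof -
  obtain a where a: "\<And>xs. length xs = k \<Longrightarrow> eval a xs = Some (A xs)"
    using A by (auto simp: total_recursive_def)
  obtain b where b: "\<And>ys. length ys = Suc (Suc k) \<Longrightarrow>
      eval b ys = Some (B (ys ! 0) (ys ! 1) (tl (tl ys)))"
    using B by (auto simp: total_recursive_def)
  have "rec_nat (eval a xs) (\<lambda>m r. Option.bind r (\<lambda>v. eval b (m # v # xs))) n
      = Some (rec_nat (A xs) (\<lambda>m r. B m r xs) n)" if "length xs = k" for n xs
    using that by (induction n) (simp_all add: a b)
  then have "eval (PrimRec a b) ys = Some (rec_nat (A (tl ys)) (\<lambda>m r. B m r (tl ys)) (ys ! 0))"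
    if "length ys = Suc k" for ys
    using that by (cases ys) auto
  then have "total_recursive (Suc k) (\<lambda>ys. rec_nat (A (tl ys)) (\<lambda>m r. B m r (tl ys)) (ys ! 0))"
    unfolding total_recursive_def by blast
  from total_recursive_Cons[OF this N] show ?thesis
    by simp
qed

text \<open>Since \<open>F\<close> is total and always has a zero, the definedness test of
  \<open>Mu\<close> succeeds.\<close>

lemma total_recursive_Least:
  assumes F: "total_recursive (Suc k) F" and ex: "\<And>xs. length xs = k \<Longrightarrow> \<exists>n. F (n # xs) = 0"
  shows "total_recursive k (\<lambda>xs. LEAST n. F (n # xs) = 0)"
proof -
  obtain f where "\<And>xs. length xs = Suc k \<Longrightarrow> eval f xs = Some (F xs)"
    using F by (auto simp: total_recursive_def)
  then have "eval (Mu f) xs = Some (LEAST n. F (n # xs) = 0)" if "length xs = k" for xs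
    using that ex by simp
  then show ?thesis
    unfolding total_recursive_def by blast
qed

lemma total_recursive_add:
  assumes "total_recursive k F" "total_recursive k G"
  shows "total_recursive k (\<lambda>xs. F xs + G xs)"
proof -
  have "total_recursive k (\<lambda>xs. rec_nat (G xs) (\<lambda>m r. Suc r) (F xs))"
    by (intro total_recursive_rec_nat assms total_recursive_Suc total_recursive_nth) simp
  moreover have "rec_nat b (\<lambda>m r. Suc r) a = a + b" for a b
    by (induction a) auto
  ultimately show ?thesis
    by simp
qed

lemma total_recursive_mult:
  assumes "total_recursive k F" "total_recursive k G"
  shows "total_recursive k (\<lambda>xs. F xs * G xs)"
proof -
  have "total_recursive k (\<lambda>xs. rec_nat 0 (\<lambda>m r. r + G xs) (F xs))"
    by (intro total_recursive_rec_nat assms total_recursive_const total_recursive_add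
        total_recursive_nth total_recursive_tl) simp
  moreover have "rec_nat 0 (\<lambda>m r. r + b) a = a * b" for a b :: nat
    by (induction a) auto
  ultimately show ?thesis
    by simp
qed

lemma total_recursive_diff:
  assumes "total_recursive k F" "total_recursive k G"
  shows "total_recursive k (\<lambda>xs. F xs - G xs)"
proof -
  have pred: "total_recursive k (\<lambda>xs. F xs - 1)" if "total_recursive k F" for k F
  proof -
    have "total_recursive k (\<lambda>xs. rec_nat 0 (\<lambda>m r. m) (F xs))"
      by (intro total_recursive_rec_nat that total_recursive_const total_recursive_nth) simp
    moreover have "rec_nat 0 (\<lambda>m r. m) a = a - 1" for a :: nat
      by (cases a) auto
    ultimately show ?thesis
      by simp
  qed
  have "total_recursive k (\<lambda>xs. rec_nat (F xs) (\<lambda>m r. r - 1) (G xs))"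
    by (intro total_recursive_rec_nat assms pred total_recursive_nth) simp
  moreover have "rec_nat a (\<lambda>m r. r - 1) b = a - b" for a b :: nat
    by (induction b) auto
  ultimately show ?thesis
    by simp
qed

section \<open>Decidable relations, case distinction and bounded quantification\<close>

lemma recursive_rel_le:
  assumes "total_recursive k F" "total_recursive k G"
  shows "recursive_rel k (\<lambda>xs. F xs \<le> G xs)"
proof -
  \<comment> \<open>Truncated subtraction: the inner difference vanishes exactly when the relation
    holds.\<close>
  have "total_recursive k (\<lambda>xs. 1 - (F xs - G xs))"
    by (intro total_recursive_diff total_recursive_const assms)
  then show ?thesis
    unfolding recursive_rel_iff by (rule total_recursive_cong) auto
qed

lemma recursive_rel_not:
  assumes "recursive_rel k R"
  shows "recursive_rel k (\<lambda>xs. \<not> R xs)"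
proof -
  have "total_recursive k (\<lambda>xs. 1 - (if R xs then 1 else 0))"
    using assms unfolding recursive_rel_iff by (intro total_recursive_diff total_recursive_const)
  then show ?thesis
    unfolding recursive_rel_iff by (rule total_recursive_cong) auto
qed

lemma recursive_rel_conj:
  assumes "recursive_rel k R" "recursive_rel k S"
  shows "recursive_rel k (\<lambda>xs. R xs \<and> S xs)"
proof -
  have "total_recursive k (\<lambda>xs. (if R xs then 1 else 0) * (if S xs then 1 else 0))"
    using assms unfolding recursive_rel_iff by (rule total_recursive_mult)
  then show ?thesis
    unfolding recursive_rel_iff by (rule total_recursive_cong) auto
qed

lemma recursive_rel_disj:
  assumes "recursive_rel k R" "recursive_rel k S"
  shows "recursive_rel k (\<lambda>xs. R xs \<or> S xs)"
  using recursive_rel_not[OF recursive_rel_conj[OF assms[THEN recursive_rel_not]]] by simp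

lemma recursive_rel_iff_rel:
  assumes "recursive_rel k R" "recursive_rel k S"
  shows "recursive_rel k (\<lambda>xs. R xs \<longleftrightarrow> S xs)"
proof (rule recursive_rel_cong)
  show "recursive_rel k (\<lambda>xs. (R xs \<and> S xs) \<or> (\<not> R xs \<and> \<not> S xs))"
    by (intro recursive_rel_disj recursive_rel_conj recursive_rel_not assms)
qed auto

lemma recursive_rel_eq:
  assumes "total_recursive k F" "total_recursive k G"
  shows "recursive_rel k (\<lambda>xs. F xs = G xs)"
  using recursive_rel_conj[OF recursive_rel_le recursive_rel_le] assms
  by (simp add: order_eq_iff)

lemma recursive_rel_True: "recursive_rel k (\<lambda>_. True)"
  using total_recursive_const[of k 1] by (simp add: recursive_rel_iff)

lemma recursive_rel_ball:
  assumes "\<And>g. g \<in> set gs \<Longrightarrow> recursive_rel k (R g)"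
  shows "recursive_rel k (\<lambda>xs. \<forall>g\<in>set gs. R g xs)"
  using assms by (induction gs) (auto intro: recursive_rel_True recursive_rel_conj)

lemma total_recursive_if:
  assumes "recursive_rel k R" "total_recursive k F" "total_recursive k G"
  shows "total_recursive k (\<lambda>xs. if R xs then F xs else G xs)"
proof (rule total_recursive_cong)
  show "total_recursive k
      (\<lambda>xs. (if R xs then 1 else 0) * F xs + (if \<not> R xs then 1 else 0) * G xs)"
    using assms(1) recursive_rel_not[OF assms(1)] unfolding recursive_rel_iff
    by (intro total_recursive_add total_recursive_mult assms)
qed auto

lemma recursive_rel_bex_less:
  assumes N: "total_recursive k N" and R: "recursive_rel (Suc k) (\<lambda>ys. R (ys ! 0) (tl ys))"
  shows "recursive_rel k (\<lambda>xs. \<exists>v<N xs. R v xs)"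
proof -
  \<comment> \<open>The recursion below passes its accumulator as argument 1, which \<open>R\<close>
    does not take, so the projections skip that position.\<close>
  have "recursive_rel (Suc (Suc k)) (\<lambda>ys. R (ys ! 0) (tl (tl ys)))"
  proof -
    define F where "F = (\<lambda>ys. if R (ys ! 0) (tl ys) then 1 else 0 :: nat)"
    have "total_recursive (Suc k) F"
      using R unfolding recursive_rel_iff F_def .
    then have "total_recursive (Suc (Suc k))
        (\<lambda>ys. F (map (\<lambda>G. G ys) (map (\<lambda>i ys. ys ! (if i = 0 then 0 else Suc i)) [0..<Suc k])))"
      by (rule total_recursive_comp) (auto intro!: total_recursive_nth)
    then have "total_recursive (Suc (Suc k)) (\<lambda>ys. F (ys ! 0 # tl (tl ys)))"
      by (rule total_recursive_cong)
        (auto intro!: arg_cong[of _ _ F] nth_equalityI simp: nth_Cons nth_tl simp del: upt_Suc split: nat.splits)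
    then show ?thesis
      unfolding recursive_rel_iff F_def by simp
  qed
  then have "total_recursive k (\<lambda>xs. rec_nat 0 (\<lambda>v r. if R v xs then 1 else r) (N xs))"
    by (intro total_recursive_rec_nat[OF N] total_recursive_if total_recursive_const
        total_recursive_nth) auto
  moreover have "rec_nat 0 (\<lambda>v r. if R v xs then 1 else r) n = (if \<exists>v<n. R v xs then 1 else 0 :: nat)"
    for n xs by (induction n) (auto simp: less_Suc_eq)
  ultimately show ?thesis
    by (simp add: recursive_rel_iff)
qed

section \<open>Decoding finite sets and pairs\<close>

lemma total_recursive_half:
  assumes "total_recursive k F"
  shows "total_recursive k (\<lambda>xs. F xs mod 2)" "total_recursive k (\<lambda>xs. F xs div 2)"
proof -
  have mod: "total_recursive k (\<lambda>xs. F xs mod 2)" if "total_recursive k F" for k F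
  proof -
    have "total_recursive k (\<lambda>xs. rec_nat 0 (\<lambda>m r. 1 - r) (F xs))"
      by (intro total_recursive_rec_nat that total_recursive_const total_recursive_diff
          total_recursive_nth) simp
    moreover have "rec_nat 0 (\<lambda>m r. 1 - r) n = n mod 2" for n :: nat
      by (induction n) (simp_all add: mod_Suc)
    ultimately show ?thesis
      by simp
  qed
  then show "total_recursive k (\<lambda>xs. F xs mod 2)"
    using assms .
  \<comment> \<open>Half of n, rounded down, is the number of odd m below n.\<close>
  have "total_recursive k (\<lambda>xs. rec_nat 0 (\<lambda>m r. r + m mod 2) (F xs))"
    by (intro total_recursive_rec_nat assms total_recursive_const total_recursive_add mod
        total_recursive_nth) simp_all
  moreover have "rec_nat 0 (\<lambda>m r. r + m mod 2) n = n div 2" for n :: nat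
  proof (induction n)
    case (Suc n)
    then show ?case by simp presburger
  qed simp
  ultimately show "total_recursive k (\<lambda>xs. F xs div 2)"
    by simp
qed

lemma recursive_rel_set_decode:
  assumes "total_recursive k V" "total_recursive k U"
  shows "recursive_rel k (\<lambda>xs. V xs \<in> set_decode (U xs))"
proof -
  \<comment> \<open>Halving u repeatedly, v times in all, moves binary digit v to the units place,
    where parity reads it off.\<close>
  have "rec_nat u (\<lambda>_ r. r div 2) v = u div 2 ^ v" for u v :: nat
    by (induction v) (simp_all add: div_mult2_eq[symmetric] mult.commute)
  moreover have "recursive_rel k (\<lambda>xs. rec_nat (U xs) (\<lambda>_ r. r div 2) (V xs) mod 2 = 1)"
    by (intro recursive_rel_eq total_recursive_half total_recursive_rec_nat assms
        total_recursive_const total_recursive_nth) simp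
  ultimately show ?thesis
    by (simp add: set_decode_def odd_iff_mod_2_eq_one)
qed

lemma total_recursive_triangle:
  "total_recursive k F \<Longrightarrow> total_recursive k (\<lambda>xs. triangle (F xs))"
  unfolding triangle_def
  by (intro total_recursive_half total_recursive_mult total_recursive_Suc)

lemma total_recursive_pair:
  "total_recursive k F \<Longrightarrow> total_recursive k G \<Longrightarrow> total_recursive k (\<lambda>xs. pair (F xs) (G xs))"
  unfolding prod_encode_def prod.case
  by (intro total_recursive_add total_recursive_triangle)

text \<open>
  The sum of the two components of z is the least d such that z is less than the (d+1)st
  triangular number.
\<close>

lemma prod_decode_Least:
  defines "d \<equiv> \<lambda>z. LEAST d. Suc z - triangle (Suc d) = 0"
  shows "fst (prod_decode z) = z - triangle (d z)"
    and "snd (prod_decode z) = d z - (z - triangle (d z))"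
proof -
  obtain m n where mn: "prod_decode z = (m, n)"
    by fastforce
  have z: "z = triangle (m + n) + m"
    using prod_decode_inverse[of z] by (simp add: mn prod_encode_def)
  have "d z = m + n"
    unfolding d_def
  proof (rule Least_equality)
    show "Suc z - triangle (Suc (m + n)) = 0"
      by (simp add: z)
    fix e
    assume e: "Suc z - triangle (Suc e) = 0"
    show "m + n \<le> e"
    proof (rule ccontr)
      assume "\<not> m + n \<le> e"
      then have "triangle (Suc e) \<le> triangle (m + n)"
        unfolding triangle_def by (intro div_le_mono mult_le_mono) auto
      then show False
        using e z by linarith
    qed
  qed
  then show "fst (prod_decode z) = z - triangle (d z)"
    and "snd (prod_decode z) = d z - (z - triangle (d z))"
    by (simp_all add: mn) (simp_all add: z)
qed

lemma total_recursive_prod_decode: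
  assumes "total_recursive k F"
  shows "total_recursive k (\<lambda>xs. fst (prod_decode (F xs)))"
    and "total_recursive k (\<lambda>xs. snd (prod_decode (F xs)))"
proof -
  define d where "d z = (LEAST d. Suc z - triangle (Suc d) = 0)" for z
  have "total_recursive 1 (\<lambda>xs. LEAST d. Suc ((d # xs) ! 1) - triangle (Suc ((d # xs) ! 0)) = 0)"
  proof (rule total_recursive_Least)
    show "total_recursive (Suc 1) (\<lambda>xs. Suc (xs ! 1) - triangle (Suc (xs ! 0)))"
      by (intro total_recursive_diff total_recursive_triangle total_recursive_Suc
          total_recursive_nth) auto
    \<comment> \<open>The search stops at d = z at the latest. With truncated subtraction, the
      vanishing difference says that z is less than \<open>triangle (Suc z)\<close>.\<close>
    have "Suc z - triangle (Suc z) = 0" for z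
      by (induction z) auto
    then show "\<exists>d. Suc ((d # xs) ! 1) - triangle (Suc ((d # xs) ! 0)) = 0" for xs
      by (metis nth_Cons_0 nth_Cons_Suc One_nat_def)
  qed
  then have "total_recursive 1 (\<lambda>xs. d (xs ! 0))"
    by (simp add: d_def)
  from total_recursive_comp1[OF this assms] have d: "total_recursive k (\<lambda>xs. d (F xs))"
    by simp
  show "total_recursive k (\<lambda>xs. fst (prod_decode (F xs)))"
    "total_recursive k (\<lambda>xs. snd (prod_decode (F xs)))"
    unfolding prod_decode_Least d_def[symmetric]
    by (intro total_recursive_diff total_recursive_triangle d assms)+
qed

section \<open>Evaluation with a bounded search\<close>

text \<open>
  The state of the search is 0 while it runs, 1 after it has met an undefined value and v + 2
  when the value v has been found. Function values are coded by 0 for undefined and v + 1 for v.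
\<close>

definition search :: "(nat \<Rightarrow> nat) \<Rightarrow> nat \<Rightarrow> nat" where
  "search g s = rec_nat 0
     (\<lambda>m r. if r \<noteq> 0 then r else if g m = 1 then m + 2 else if g m = 0 then 1 else 0) s"

text \<open>The clock \<open>s\<close> bounds the range of every \<open>Mu\<close> search, at all
  depths of nesting, so evaluation always ends. In the last clause, subtracting 1 turns the states 0
  and 1 into the code for undefined and the state v + 2 into the code of v.\<close>

fun clocked :: "recf \<Rightarrow> nat \<Rightarrow> nat list \<Rightarrow> nat" where
  "clocked Zero s xs = 1"
| "clocked Succ s xs = (if length xs = 1 then Suc (Suc (xs ! 0)) else 0)"
| "clocked (Proj i) s xs = (if i < length xs then Suc (xs ! i) else 0)"
| "clocked (Comp f gs) s xs =
     (if \<forall>g\<in>set gs. clocked g s xs \<noteq> 0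
      then clocked f s (map (\<lambda>g. clocked g s xs - 1) gs) else 0)"
| "clocked (PrimRec f g) s xs =
     (case xs of
        [] \<Rightarrow> 0
      | n # ys \<Rightarrow>
          rec_nat (clocked f s ys) (\<lambda>m r. if r = 0 then 0 else clocked g s (m # (r - 1) # ys)) n)"
| "clocked (Mu f) s xs = search (\<lambda>m. clocked f s (m # xs)) s - 1"

section \<open>The bounded search, and agreement of clocked evaluation with
  \<open>eval\<close>\<close>

lemma search_eq_0_iff: "search g s = 0 \<longleftrightarrow> (\<forall>m<s. g m > 1)"
  unfolding search_def by (induction s) (auto simp: less_Suc_eq)

lemma search_eq_Suc_Suc_iff:
  "search g s = Suc (Suc v) \<longleftrightarrow> v < s \<and> g v = 1 \<and> (\<forall>m<v. g m > 1)"
proof (induction s)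
  case 0
  show ?case by (simp add: search_def)
next
  case (Suc s)
  have step: "search g (Suc s) = (if search g s \<noteq> 0 then search g s
      else if g s = 1 then s + 2 else if g s = 0 then 1 else 0)"
    by (simp add: search_def)
  show ?case
  proof (cases "search g s = 0")
    case True
    then have "\<forall>m<s. g m > 1"
      by (simp add: search_eq_0_iff)
    then show ?thesis
      using True step by (auto simp: less_Suc_eq)
  next
    case False
    \<comment> \<open>A search that has stopped keeps its state, and the m that stopped it excludes
      s as a first zero.\<close>
    then obtain m where "m < s" "g m \<le> 1"
      by (auto simp: search_eq_0_iff not_less)
    then show ?thesis
      using False step Suc by (auto simp: less_Suc_eq)
  qed
qed

text \<open>The least zero lies at or below any n accepted by the definition, so definedness below n
  carries over, and minimality makes the earlier values positive. This form matches
  \<open>search_eq_Suc_Suc_iff\<close>.\<close>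

lemma eval_Mu_eq_Some_iff:
  "eval (Mu f) xs = Some v \<longleftrightarrow>
     eval f (v # xs) = Some 0 \<and> (\<forall>m<v. \<exists>w. eval f (m # xs) = Some (Suc w))"
  (is "_ \<longleftrightarrow> ?R")
proof
  assume L: "eval (Mu f) xs = Some v"
  then obtain n where n: "eval f (n # xs) = Some 0" "\<forall>m<n. eval f (m # xs) \<noteq> None"
    and v: "v = (LEAST n. eval f (n # xs) = Some 0)"
    by (auto split: if_splits)
  have "v \<le> n"
    unfolding v using n(1) by (rule Least_le)
  have "eval f (v # xs) = Some 0"
    unfolding v using n(1) by (rule LeastI)
  moreover have "\<exists>w. eval f (m # xs) = Some (Suc w)" if "m < v" for m
  proof -
    have "eval f (m # xs) \<noteq> Some 0"
      using that unfolding v by (rule not_less_Least)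
    moreover have "eval f (m # xs) \<noteq> None"
      using that \<open>v \<le> n\<close> n(2) by simp
    ultimately show ?thesis
      by (metis not0_implies_Suc option.exhaust)
  qed
  ultimately show ?R
    by blast
next
  assume R: ?R
  have "(LEAST n. eval f (n # xs) = Some 0) = v"
    using R by (intro Least_equality) (auto simp: not_less[symmetric])
  moreover have "\<exists>n. eval f (n # xs) = Some 0 \<and> (\<forall>m<n. eval f (m # xs) \<noteq> None)"
    using R by force
  ultimately show "eval (Mu f) xs = Some v"
    by simp
qed

text \<open>A positive code arises only from a genuine computation: a search cut off by the clock or
  stopped by an undefined value yields 0. The induction on the program keeps \<open>s\<close>
  fixed.\<close>

lemma clocked_sound: "clocked c s xs = Suc v \<Longrightarrow> eval c xs = Some v"
proof (induction c arbitrary: xs v)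
  case Succ
  then show ?case
    by (auto split: if_splits simp: length_Suc_conv)
next
  case (Comp f gs)
  from Comp.prems have ne: "\<forall>g\<in>set gs. clocked g s xs \<noteq> 0"
    and f: "clocked f s (map (\<lambda>g. clocked g s xs - 1) gs) = Suc v"
    by (auto split: if_splits)
  have "eval g xs = Some (clocked g s xs - 1)" if "g \<in> set gs" for g
    using that ne by (intro Comp.IH(2)) auto
  then have "those (map (\<lambda>g. eval g xs) gs) = Some (map (\<lambda>g. clocked g s xs - 1) gs)"
    by (simp add: those_map)
  then show ?case
    using Comp.IH(1)[OF f] by simp
next
  case (PrimRec f g)
  from PrimRec.prems obtain n ys where xs: "xs = n # ys"
    by (auto split: list.splits)
  have "rec_nat (clocked f s ys) (\<lambda>m r. if r = 0 then 0 else clocked g s (m # (r - 1) # ys)) n = Suc v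
    \<Longrightarrow> rec_nat (eval f ys) (\<lambda>m r. Option.bind r (\<lambda>v. eval g (m # v # ys))) n = Some v" for n v
  proof (induction n arbitrary: v)
    case 0
    then show ?case
      by (simp add: PrimRec.IH)
  next
    case (Suc n)
    let ?r = "rec_nat (clocked f s ys) (\<lambda>m r. if r = 0 then 0 else clocked g s (m # (r - 1) # ys)) n"
    obtain w where w: "?r = Suc w" and v: "clocked g s (n # w # ys) = Suc v"
      using Suc.prems by (cases ?r) auto
    show ?case
      by (simp add: Suc.IH[OF w] PrimRec.IH(2)[OF v])
  qed
  then show ?case
    using PrimRec.prems by (simp add: xs)
next
  case (Mu f)
  from Mu.prems have "search (\<lambda>m. clocked f s (m # xs)) s = Suc (Suc v)"
    by simp
  then have v: "clocked f s (v # xs) = Suc 0" and less: "\<And>m. m < v \<Longrightarrow> clocked f s (m # xs) > 1"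
    by (simp_all add: search_eq_Suc_Suc_iff)
  have "\<exists>w. eval f (m # xs) = Some (Suc w)" if "m < v" for m
  proof -
    from less[OF that] obtain w where "clocked f s (m # xs) = Suc (Suc w)"
      by (auto dest: less_imp_Suc_add)
    then show ?thesis
      by (blast intro: Mu.IH)
  qed
  then show ?case
    unfolding eval_Mu_eq_Some_iff by (blast intro: Mu.IH v)
qed (simp_all split: if_splits)

text \<open>A terminating computation calls only finitely many subcomputations, each correct from
  some stage on. Stating this with \<open>eventually\<close> lets finitely many thresholds be
  merged; a \<open>Mu\<close> search must in addition be given a clock beyond the value it
  finds.\<close>

lemma clocked_complete:
  "eval c xs = Some v \<Longrightarrow> \<forall>\<^sub>F s in sequentially. clocked c s xs = Suc v"
proof (induction c arbitrary: xs v)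
  case Succ
  then show ?case
    by (auto split: list.splits)
next
  case (Comp f gs)
  from Comp.prems have ne: "\<forall>g\<in>set gs. eval g xs \<noteq> None"
    and f: "eval f (map (\<lambda>g. the (eval g xs)) gs) = Some v"
    by (auto simp: those_map split: if_splits)
  have "\<forall>\<^sub>F s in sequentially. \<forall>g\<in>set gs. clocked g s xs = Suc (the (eval g xs))"
    using ne Comp.IH(2) by (intro eventually_ball_finite) auto
  with Comp.IH(1)[OF f] show ?case
  proof eventually_elim
    case (elim s)
    then have "map (\<lambda>g. clocked g s xs - 1) gs = map (\<lambda>g. the (eval g xs)) gs"
      by simp
    with elim show ?case
      by (simp del: map_eq_conv)
  qed
next
  case (PrimRec f g)
  from PrimRec.prems obtain n ys where xs: "xs = n # ys"
    by (auto split: list.splits)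
  have "rec_nat (eval f ys) (\<lambda>m r. Option.bind r (\<lambda>v. eval g (m # v # ys))) n = Some v \<Longrightarrow>
    \<forall>\<^sub>F s in sequentially. rec_nat (clocked f s ys)
      (\<lambda>m r. if r = 0 then 0 else clocked g s (m # (r - 1) # ys)) n = Suc v" for n v
  proof (induction n arbitrary: v)
    case 0
    then show ?case
      by (simp add: PrimRec.IH)
  next
    case (Suc n)
    from Suc.prems obtain w where
      w: "rec_nat (eval f ys) (\<lambda>m r. Option.bind r (\<lambda>v. eval g (m # v # ys))) n = Some w"
      and v: "eval g (n # w # ys) = Some v"
      by (auto simp: bind_eq_Some_conv)
    from Suc.IH[OF w] PrimRec.IH(2)[OF v] show ?case
      by eventually_elim simp
  qed
  then show ?case
    using PrimRec.prems by (simp add: xs)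
next
  case (Mu f)
  from Mu.prems have z: "eval f (v # xs) = Some 0"
    and nz: "\<forall>m<v. \<exists>w. eval f (m # xs) = Some (Suc w)"
    unfolding eval_Mu_eq_Some_iff by auto
  have "\<forall>\<^sub>F s in sequentially. \<forall>m\<in>{..<v}. clocked f s (m # xs) > 1"
  proof (intro eventually_ball_finite ballI)
    fix m
    assume "m \<in> {..<v}"
    then obtain w where "eval f (m # xs) = Some (Suc w)"
      using nz by auto
    from Mu.IH[OF this] show "\<forall>\<^sub>F s in sequentially. clocked f s (m # xs) > 1"
      by eventually_elim simp
  qed simp
  with Mu.IH[OF z] eventually_gt_at_top[of v] show ?case
  proof eventually_elim
    case (elim s)
    then have "search (\<lambda>m. clocked f s (m # xs)) s = Suc (Suc v)"
      unfolding search_eq_Suc_Suc_iff by auto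
    then show ?case
      by simp
  qed
qed (auto split: if_splits)

lemma eventually_clocked_iff:
  "\<forall>\<^sub>F s in sequentially. clocked c s xs \<noteq> 0 \<longleftrightarrow> eval c xs \<noteq> None"
proof (cases "eval c xs")
  case None
  then have "clocked c s xs = 0" for s
    using clocked_sound[of c s xs] by (cases "clocked c s xs") auto
  then show ?thesis
    using None by simp
next
  case (Some v)
  from clocked_complete[OF this] show ?thesis
    by eventually_elim (simp add: Some)
qed

text \<open>The program is fixed while the clock is an ordinary argument. Each clause is a
  composition, a primitive recursion or a bounded search; the arity is generalized because
  subprograms take lists of other lengths.\<close>

lemma total_recursive_clocked: "total_recursive (Suc k) (\<lambda>ys. clocked c (ys ! 0) (tl ys))"
proof (induction c arbitrary: k)
  case Zero
  show ?case
    by (simp add: total_recursive_const)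
next
  case Succ
  show ?case
  proof (cases "k = 1")
    case True
    have "total_recursive (Suc k) (\<lambda>ys. Suc (Suc (ys ! 1)))"
      using True by (intro total_recursive_Suc total_recursive_nth) simp
    then show ?thesis
      by (rule total_recursive_cong) (auto simp: True nth_tl)
  next
    case False
    show ?thesis
      by (rule total_recursive_cong[OF total_recursive_const[of _ 0]]) (use False in simp)
  qed
next
  case (Proj i)
  show ?case
  proof (cases "i < k")
    case True
    have "total_recursive (Suc k) (\<lambda>ys. Suc (ys ! Suc i))"
      using True by (intro total_recursive_Suc total_recursive_nth) simp
    then show ?thesis
      by (rule total_recursive_cong) (auto simp: True nth_tl)
  next
    case False
    show ?thesis
      by (rule total_recursive_cong[OF total_recursive_const[of _ 0]]) (use False in simp)
  qed
next
  case (Comp f gs)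
  define G where "G = (\<lambda>g ys. clocked g (ys ! 0) (tl ys))"
  have G: "total_recursive (Suc k) (G g)" if "g \<in> set gs" for g
    unfolding G_def using Comp.IH(2)[OF that] .
  have "total_recursive (Suc k) (\<lambda>ys. (\<lambda>zs. clocked f (zs ! 0) (tl zs))
      (map (\<lambda>H. H ys) ((\<lambda>ys. ys ! 0) # map (\<lambda>g ys. G g ys - 1) gs)))"
    by (rule total_recursive_comp[OF Comp.IH(1)[of "length gs"]])
      (auto intro!: total_recursive_nth total_recursive_diff total_recursive_const G simp del: One_nat_def)
  then have "total_recursive (Suc k)
      (\<lambda>ys. if \<forall>g\<in>set gs. \<not> G g ys = 0
        then clocked f (ys ! 0) (map (\<lambda>g. G g ys - 1) gs) else 0)"
    by (intro total_recursive_if recursive_rel_ball recursive_rel_not recursive_rel_eq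
        total_recursive_const G) (simp_all add: comp_def)
  then show ?case
    unfolding G_def by simp
next
  case (PrimRec f g)
  show ?case
  proof (cases k)
    case 0
    show ?thesis
      by (rule total_recursive_cong[OF total_recursive_const[of _ 0]]) (auto simp: 0 length_Suc_conv)
  next
    case (Suc j)
    define F where "F = (\<lambda>ys. clocked f (ys ! 0) (tl ys))"
    define G where "G = (\<lambda>ys. clocked g (ys ! 0) (tl ys))"
    have F: "total_recursive (Suc j) F"
      unfolding F_def by (rule PrimRec.IH)
    have G: "total_recursive (Suc (Suc (Suc j))) G"
      unfolding G_def by (rule PrimRec.IH)
    have "total_recursive (Suc (Suc j)) (\<lambda>ys. F (map (\<lambda>H. H ys)
        ((\<lambda>ys. ys ! 0) # map (\<lambda>i ys. ys ! (2 + i)) [0..<j])))"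
      by (rule total_recursive_comp[OF F]) (auto intro!: total_recursive_nth)
    then have base: "total_recursive (Suc (Suc j)) (\<lambda>ys. F (ys ! 0 # drop 2 ys))"
      by (rule total_recursive_cong)
        (auto intro!: arg_cong[of _ _ F] nth_equalityI simp: nth_Cons split: nat.splits)
    \<comment> \<open>The incoming list consists of counter, accumulated code, clock, recursion
      argument and parameters. The clock moves to the front, the code is decreased to the value it
      stands for, and the recursion argument is dropped.\<close>
    have "total_recursive (Suc (Suc (Suc (Suc j)))) (\<lambda>ys. G (map (\<lambda>H. H ys)
        ((\<lambda>ys. ys ! 2) # (\<lambda>ys. ys ! 0) # (\<lambda>ys. ys ! 1 - 1) # map (\<lambda>i ys. ys ! (4 + i)) [0..<j])))"
      by (rule total_recursive_comp[OF G])
        (auto intro!: total_recursive_nth total_recursive_diff total_recursive_const simp del: One_nat_def)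
    then have step: "total_recursive (Suc (Suc (Suc (Suc j))))
        (\<lambda>ys. G (tl (tl ys) ! 0 # ys ! 0 # (ys ! 1 - 1) # drop 2 (tl (tl ys))))"
      by (rule total_recursive_cong)
        (auto intro!: arg_cong[of _ _ G] nth_equalityI
          simp: nth_Cons length_Suc_conv eval_nat_numeral split: nat.splits)
    have "total_recursive (Suc (Suc j)) (\<lambda>ys. rec_nat (F (ys ! 0 # drop 2 ys))
        (\<lambda>m r. if r = 0 then 0 else G (ys ! 0 # m # (r - 1) # drop 2 ys)) (ys ! 1))"
      by (intro total_recursive_rec_nat base total_recursive_if step recursive_rel_eq
          total_recursive_nth total_recursive_const) auto
    then show ?thesis
      unfolding Suc F_def G_def
      by (rule total_recursive_cong) (auto simp: length_Suc_conv cong: if_cong)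
  qed
next
  case (Mu f)
  define F where "F = (\<lambda>ys. clocked f (ys ! 0) (tl ys))"
  have F: "total_recursive (Suc (Suc k)) F"
    unfolding F_def by (rule Mu.IH)
  \<comment> \<open>Here the list consists of counter, search state, clock and parameters; the state
    is dropped and the clock put first.\<close>
  have "total_recursive (Suc (Suc (Suc k))) (\<lambda>ys. F (map (\<lambda>H. H ys)
      ((\<lambda>ys. ys ! 2) # (\<lambda>ys. ys ! 0) # map (\<lambda>i ys. ys ! (3 + i)) [0..<k])))"
    by (rule total_recursive_comp[OF F]) (auto intro!: total_recursive_nth)
  then have step: "total_recursive (Suc (Suc (Suc k)))
      (\<lambda>ys. F (tl (tl ys) ! 0 # ys ! 0 # tl (tl (tl ys))))"
    by (rule total_recursive_cong)
      (auto intro!: arg_cong[of _ _ F] nth_equalityI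
        simp: nth_Cons length_Suc_conv eval_nat_numeral split: nat.splits)
  have "total_recursive (Suc k) (\<lambda>ys. search (\<lambda>m. F (ys ! 0 # m # tl ys)) (ys ! 0) - 1)"
    unfolding search_def
    by (intro total_recursive_diff total_recursive_rec_nat total_recursive_if recursive_rel_not
        recursive_rel_eq total_recursive_add step total_recursive_nth total_recursive_const) auto
  then show ?case
    by (simp add: F_def)
qed

section \<open>Membership and hardness\<close>

text \<open>From some stage on \<open>P\<close> has the constant truth value \<open>p\<close>. This
  rewrites a limit in \<forall>\<exists> form, ready to follow further universal
  quantifiers.\<close>

lemma infinitely_often_iff_limit:
  fixes P :: "nat \<Rightarrow> bool"
  assumes "\<forall>\<^sub>F t in sequentially. P t \<longleftrightarrow> p"
  shows "(\<forall>s. \<exists>t\<ge>s. P t) \<longleftrightarrow> p"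
proof -
  obtain N where N: "\<And>t. t \<ge> N \<Longrightarrow> P t \<longleftrightarrow> p"
    using assms by (auto simp: eventually_sequentially)
  show ?thesis
    using N by (metis nle_le)
qed

text \<open>Each quantifier puts its variable at the head, so the innermost one, \<open>b\<close>,
  comes first in the list.\<close>

lemma Pi_rel_2_iff:
  "Pi_rel 2 1 R \<longleftrightarrow>
     (\<exists>Q. recursive_rel 3 Q \<and> (\<forall>p. R [p] \<longleftrightarrow> (\<forall>a. \<exists>b. Q [b, a, p])))"
proof
  assume "Pi_rel 2 1 R"
  then obtain S Q where "recursive_rel 3 Q"
    and "\<forall>xs. length xs = 2 \<longrightarrow> (S xs \<longleftrightarrow> (\<exists>y. Q (y # xs)))"
    and "\<forall>xs. length xs = 1 \<longrightarrow> (R xs \<longleftrightarrow> (\<forall>y. S (y # xs)))"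
    by (auto simp: numeral_2_eq_2 numeral_3_eq_3)
  then show "\<exists>Q. recursive_rel 3 Q \<and> (\<forall>p. R [p] \<longleftrightarrow> (\<forall>a. \<exists>b. Q [b, a, p]))"
    by (intro exI[of _ Q]) simp
next
  assume "\<exists>Q. recursive_rel 3 Q \<and> (\<forall>p. R [p] \<longleftrightarrow> (\<forall>a. \<exists>b. Q [b, a, p]))"
  then obtain Q where Q: "recursive_rel 3 Q" "\<And>p. R [p] \<longleftrightarrow> (\<forall>a. \<exists>b. Q [b, a, p])"
    by blast
  define S where "S = (\<lambda>xs. \<exists>b. Q (b # xs))"
  have "Sigma_rel (Suc 0) 2 S"
    using Q(1) by (auto simp: S_def numeral_2_eq_2 numeral_3_eq_3)
  moreover have "\<forall>xs. length xs = 1 \<longrightarrow> (R xs \<longleftrightarrow> (\<forall>y. S (y # xs)))"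
    using Q(2) by (auto simp: S_def length_Suc_conv)
  ultimately show "Pi_rel 2 1 R"
    unfolding numeral_2_eq_2 Pi_rel.simps(2)[of "Suc 0"] by (auto simp del: Sigma_rel.simps)
qed

text \<open>Contraposition turns the condition on y into a disjunction: a difference on the finite
  set, or equality of columns. Equality is then tested pointwise, and its quantifier over w moves
  out because the first disjunct does not involve w.\<close>

lemma in_DS_iff:
  "triple e x u \<in> DS W \<longleftrightarrow>
     (\<forall>y w. (\<exists>v\<in>set_decode u. v \<in> column W e x \<longleftrightarrow> v \<notin> column W e y) \<or>
       (w \<in> column W e x \<longleftrightarrow> w \<in> column W e y))"
  unfolding DS_def by auto

text \<open>
  The part of \<open>in_DS_iff\<close> inside the quantifiers over y and w is a limit of recursive relations,
  since \<open>clocked\<close> converges pointwise and \<open>set_decode u\<close> is finite. A convergent relation holds in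
  the limit iff it holds at infinitely many stages, which only costs a block of the form
  \<open>\<forall>s. \<exists>t\<ge>s\<close>.
\<close>

lemma Pi_set_DS:
  assumes "uniformly_re W"
  shows "Pi_set 2 (DS W)"
proof -
  obtain c where c: "{pair e x | e x. x \<in> W e} = {z. eval c [z] \<noteq> None}"
    using assms by (auto simp: uniformly_re_def re_set_def)
  define M where "M t e j v \<longleftrightarrow> clocked c t [triple e j v] \<noteq> 0" for t e j v
  have W: "v \<in> column W e j \<longleftrightarrow> eval c [triple e j v] \<noteq> None" for e j v
  proof -
    have "v \<in> column W e j \<longleftrightarrow> triple e j v \<in> {pair e x | e x. x \<in> W e}"
      by (auto simp: column_def)
    then show ?thesis
      by (simp add: c)
  qed
  have lim: "\<forall>\<^sub>F t in sequentially. M t e j v \<longleftrightarrow> v \<in> column W e j" for e j v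
    unfolding M_def W by (rule eventually_clocked_iff)
  have M: "recursive_rel k (\<lambda>xs. M (T xs) (E xs) (J xs) (V xs))"
    if "total_recursive k T" "total_recursive k E" "total_recursive k J" "total_recursive k V"
    for k T E J V
  proof -
    have "total_recursive k (\<lambda>xs. clocked c (T xs) [triple (E xs) (J xs) (V xs)])"
      using total_recursive_comp2[of "\<lambda>ys. clocked c (ys ! 0) (tl ys)" k T
          "\<lambda>xs. triple (E xs) (J xs) (V xs)"] total_recursive_clocked[of 1 c] that
      by (simp add: total_recursive_pair numeral_2_eq_2)
    then show ?thesis
      unfolding M_def by (intro recursive_rel_not recursive_rel_eq total_recursive_const)
  qed
  define P where "P t e x u y w \<longleftrightarrow>
    (\<exists>v<u. v \<in> set_decode u \<and> (M t e x v \<longleftrightarrow> \<not> M t e y v)) \<or> (M t e x w \<longleftrightarrow> M t e y w)"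
    for t e x u y w
  \<comment> \<open>A binary digit 1 at position v forces u to be at least the v-th power of 2,
    which exceeds v. Hence the quantifier over the finite set is bounded by u.\<close>
  have bound: "v < u" if "v \<in> set_decode u" for u v
  proof -
    have "u div 2 ^ v \<noteq> 0"
      using that by (auto simp: set_decode_def intro: ccontr)
    then have "2 ^ v \<le> u"
      by (simp add: div_eq_0_iff)
    with less_exp[of v] show ?thesis
      by linarith
  qed
  have P_lim: "\<forall>\<^sub>F t in sequentially. P t e x u y w \<longleftrightarrow>
    (\<exists>v\<in>set_decode u. v \<in> column W e x \<longleftrightarrow> v \<notin> column W e y) \<or>
    (w \<in> column W e x \<longleftrightarrow> w \<in> column W e y)" for e x u y w
  proof -
    have "\<forall>\<^sub>F t in sequentially. \<forall>v\<in>set_decode u.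
        (M t e x v \<longleftrightarrow> v \<in> column W e x) \<and> (M t e y v \<longleftrightarrow> v \<in> column W e y)"
      by (intro eventually_ball_finite finite_set_decode ballI eventually_conj lim)
    with lim[of e x w] lim[of e y w] show ?thesis
      by eventually_elim (auto simp: P_def dest: bound)
  qed
  define E X U where "E p = fst (prod_decode p)"
    and "X p = fst (prod_decode (snd (prod_decode p)))"
    and "U p = snd (prod_decode (snd (prod_decode p)))" for p
  have triple_EXU: "triple (E p) (X p) (U p) = p" for p
    by (simp add: E_def X_def U_def)
  have EXU_triple: "E (triple e x u) = e" "X (triple e x u) = x" "U (triple e x u) = u" for e x u
    by (simp_all add: E_def X_def U_def)
  have EXU: "total_recursive k (\<lambda>xs. E (F xs))" "total_recursive k (\<lambda>xs. X (F xs))"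
    "total_recursive k (\<lambda>xs. U (F xs))" if "total_recursive k F" for k F
    unfolding E_def X_def U_def by (intro total_recursive_prod_decode that)+
  \<comment> \<open>The second argument codes the triple y, w, s. The maps \<open>E\<close>,
    \<open>X\<close> and \<open>U\<close> decode it as well as the input, so three universal
    quantifiers become one.\<close>
  define Q where "Q xs \<longleftrightarrow> U (xs ! 1) \<le> xs ! 0 \<and>
      P (xs ! 0) (E (xs ! 2)) (X (xs ! 2)) (U (xs ! 2)) (E (xs ! 1)) (X (xs ! 1))" for xs
  have "p \<in> DS W \<longleftrightarrow> (\<forall>q. \<exists>t. Q [t, q, p])" for p
  proof -
    have "p \<in> DS W \<longleftrightarrow> (\<forall>y w s. \<exists>t\<ge>s. P t (E p) (X p) (U p) y w)"
      using in_DS_iff[of "E p" "X p" "U p" W]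
      by (simp add: triple_EXU infinitely_often_iff_limit[OF P_lim])
    also have "\<dots> \<longleftrightarrow> (\<forall>q. \<exists>t. Q [t, q, p])"
      unfolding Q_def by simp (metis EXU_triple)
    finally show ?thesis .
  qed
  moreover have "recursive_rel 3 Q"
    unfolding Q_def P_def
    by (intro recursive_rel_conj recursive_rel_le recursive_rel_disj recursive_rel_bex_less
        recursive_rel_set_decode recursive_rel_iff_rel recursive_rel_not M EXU
        total_recursive_tl total_recursive_nth) simp_all
  ultimately show ?thesis
    unfolding Pi_set_def Pi_rel_2_iff by auto
qed

text \<open>
  Column 0 is everything and the other columns all consist of the a with a witness b, so the
  empty set separates column 0 from all columns different from it iff all a have a witness.
\<close>

lemma Pi_set_reducible_DS:
  assumes W: "acceptable_numbering W" and B: "Pi_set 2 B"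
  shows "many_one_reducible B (DS W)"
proof -
  obtain R where R: "recursive_rel 3 R"
    and B_iff: "\<And>n. n \<in> B \<longleftrightarrow> (\<forall>a. \<exists>b. R [b, a, n])"
    using B unfolding Pi_set_def Pi_rel_2_iff by auto
  define V where "V n = {pair j a | j a. j = 0 \<or> (\<exists>b. R [b, a, n])}" for n
  define E J A where "E p = fst (prod_decode p)"
    and "J p = fst (prod_decode (snd (prod_decode p)))"
    and "A p = snd (prod_decode (snd (prod_decode p)))" for p
  have V: "{pair n x | n x. x \<in> V n} = {p. J p = 0 \<or> (\<exists>b. R [b, A p, E p])}" (is "?L = ?R")
  proof (intro set_eqI iffI)
    fix p
    assume "p \<in> ?R"
    moreover have "p = pair (E p) (pair (J p) (A p))"
      by (simp add: E_def J_def A_def)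
    ultimately show "p \<in> ?L"
      unfolding V_def by blast
  qed (auto simp: V_def E_def J_def A_def)
  \<comment> \<open>Success has value 0 because \<open>Mu\<close> searches for a zero. As this
    function is total, the search is defined exactly when some b succeeds; if \<open>J\<close> is 0,
    every b does.\<close>
  have "total_recursive 2 (\<lambda>ys. if J (ys ! 1) = 0 \<or> R [ys ! 0, A (ys ! 1), E (ys ! 1)] then 0 else 1)"
  proof (intro total_recursive_if recursive_rel_disj recursive_rel_eq total_recursive_const)
    show "recursive_rel 2 (\<lambda>ys. R [ys ! 0, A (ys ! 1), E (ys ! 1)])"
      using R unfolding recursive_rel_iff A_def E_def
      by (rule total_recursive_comp3) (intro total_recursive_prod_decode total_recursive_nth; simp)+
    show "total_recursive 2 (\<lambda>ys. J (ys ! 1))"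
      unfolding J_def by (intro total_recursive_prod_decode total_recursive_nth) simp
  qed
  then obtain f where "\<And>ys. length ys = 2 \<Longrightarrow>
      eval f ys = Some (if J (ys ! 1) = 0 \<or> R [ys ! 0, A (ys ! 1), E (ys ! 1)] then 0 else 1)"
    unfolding total_recursive_def by blast
  then have "{p. J p = 0 \<or> (\<exists>b. R [b, A p, E p])} = {p. eval (Mu f) [p] \<noteq> None}"
    by auto
  then have "uniformly_re V"
    unfolding uniformly_re_def V re_set_def by blast
  then obtain g where g: "recursive_fun g" "\<And>n. V n = W (g n)"
    using W by (auto simp: acceptable_numbering_def)
  have "total_recursive 1 (\<lambda>xs. g (xs ! 0))"
    using g(1) by (simp only: recursive_fun_iff)
  \<comment> \<open>The first 0 selects column 0, the second is the canonical index of the empty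
    set.\<close>
  then have "total_recursive 1 (\<lambda>xs. triple (g (xs ! 0)) 0 0)"
    by (intro total_recursive_pair total_recursive_const)
  then have "recursive_fun (\<lambda>n. triple (g n) 0 0)"
    by (simp only: recursive_fun_iff)
  moreover have "n \<in> B \<longleftrightarrow> triple (g n) 0 0 \<in> DS W" for n
  proof -
    have "column W (g n) j = (if j = 0 then UNIV else {a. \<exists>b. R [b, a, n]})" for j
      by (auto simp: column_def g(2)[symmetric] V_def)
    then show ?thesis
      unfolding in_DS_iff B_iff by (auto split: if_splits)
  qed
  ultimately show ?thesis
    unfolding many_one_reducible_def by blast
qed

theorem theorem1:
  fixes W :: "nat \<Rightarrow> nat set"
  assumes "acceptable_numbering W"
  shows "Pi_complete 2 (DS W)"
  using Pi_set_DS Pi_set_reducible_DS assms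
  unfolding Pi_complete_def acceptable_numbering_def by blast

end
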